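(* Let $I\subset\mathbb{N}$ be a finite index set, let $X_i$ ($i\in I$) be real random variables, all continuous with probability density functions $f_{X_i}$ or all discrete with probability mass functions $f_{X_i}$, and let $A_i\in\mathbb{R}$ ($i\in I$) with $\sum_{i\in I}A_i=1$. Let $Z$ be a random variable (of the same type) whose density (respectively mass function) is $f_Z(t)=\sum_{i\in I}A_if_{X_i}(t)$. Let $g$ be a one-to-one (Borel measurable) real function defined on a Borel set that contains the values of the $X_i$ and of $Z$, such that each $g(X_i)$ has a probability density function (respectively probability mass function) $f_{g(X_i)}$. Then $$y\mapsto\sum_{i\in I}A_if_{g(X_i)}(y)$$ is a valid probability density function (respectively probability mass function): it is nonnegative (almost everywhere, in the continuous case) and integrates (respectively sums) to $1$.
   Context: A random variable $Z$ as in the claim is said to follow a mixed distribution of $(X_i)_{i\in I}$; the coefficients $A_i$ may be negative. *)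

theory Defs
  imports "HOL-Probability.Probability"
begin

(* Densities are real-valued, since they are combined with possibly negative coefficients.
   As ennreal truncates negative reals to 0, nonnegativity has to be required separately. *)
definition has_pdf :: "'a measure \<Rightarrow> ('a \<Rightarrow> real) \<Rightarrow> (real \<Rightarrow> real) \<Rightarrow> bool" where
  "has_pdf M X f \<longleftrightarrow>
     f \<in> borel_measurable borel \<and> (AE t in lborel. 0 \<le> f t) \<and>
     distributed M lborel X (\<lambda>t. ennreal (f t))"

(* "distributed M (count_space UNIV) X f" would require every subset of the reals to have a
   measurable preimage under X, so discreteness is expressed through a countable set carrying X. *)
definition has_pmf :: "'a measure \<Rightarrow> ('a \<Rightarrow> real) \<Rightarrow> (real \<Rightarrow> real) \<Rightarrow> bool" where
  "has_pmf M X f \<longleftrightarrow>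
     X \<in> borel_measurable M \<and>
     (\<exists>C. countable C \<and> (AE \<omega> in M. X \<omega> \<in> C)) \<and>
     (\<forall>t. f t = measure M {\<omega> \<in> space M. X \<omega> = t})"

definition valid_pdf :: "(real \<Rightarrow> real) \<Rightarrow> bool" where
  "valid_pdf f \<longleftrightarrow>
     f \<in> borel_measurable borel \<and> (AE t in lborel. 0 \<le> f t) \<and>
     integrable lborel f \<and> integral\<^sup>L lborel f = 1"

definition valid_pmf :: "(real \<Rightarrow> real) \<Rightarrow> bool" where
  "valid_pmf f \<longleftrightarrow> (\<forall>t. 0 \<le> f t) \<and> (f has_sum 1) UNIV"

end

theory Submission
  imports Defs
begin

text \<open>
  Linearity and the hypothesis on the density of \<open>Z\<close> give
  \<open>\<Sum>i. A i * P (X i \<in> T) = P (Z \<in> T)\<close> for every Borel set \<open>T\<close>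
  (for every one-point set \<open>T\<close> in the discrete case). Taking \<open>T\<close> to be the preimage in \<open>S\<close> of
  a set \<open>B\<close> under \<open>g\<close> shows that the signed combination of the laws of the \<open>g (X i)\<close> gives \<open>B\<close> a
  nonnegative mass.
\<close>

text \<open>The measure with density \<open>f\<close> is the law of \<open>X\<close>. Writing
  probabilities as Lebesgue integrals of real functions allows signed linear combinations of
  them.\<close>

lemma integrable_has_pdf:
  assumes "prob_space M" and "has_pdf M X f"
  shows "integrable lborel f"
    and "B \<in> sets borel \<Longrightarrow> measure M {\<omega> \<in> space M. X \<omega> \<in> B} = (LINT t:B|lborel. f t)"
proof -
  interpret prob_space M by fact
  have f [measurable]: "f \<in> borel_measurable lborel" and nn: "AE t in lborel. 0 \<le> f t"
    and d: "distributed M lborel X (\<lambda>t. ennreal (f t))"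
    using assms(2) by (auto simp: has_pdf_def)
  have X: "X \<in> measurable M lborel"
    using d by (rule distributed_measurable)
  have D: "density lborel (\<lambda>t. ennreal (f t)) = distr M lborel X"
    using d by (simp add: distributed_distr_eq_density)
  interpret D: prob_space "density lborel (\<lambda>t. ennreal (f t))"
    unfolding D by (rule prob_space_distr[OF X])
  \<comment> \<open>The constant 1 is integrable for a probability measure; since \<open>f\<close>
    is nonnegative almost everywhere, integrability of 1 against the density measure is
    integrability of \<open>f\<close>.\<close>
  show "integrable lborel f"
    using integrable_density[of "\<lambda>_. 1::real" lborel f] nn D.finite_measure_axioms by simp
  assume B: "B \<in> sets borel"
  have "measure M {\<omega> \<in> space M. X \<omega> \<in> B} = measure (distr M lborel X) B"
    using X B by (subst measure_distr) (auto intro!: arg_cong[where f = "measure M"])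
  also have "\<dots> = (LINT t|density lborel (\<lambda>t. ennreal (f t)). indicat_real B t)"
    using B by (simp add: D)
  also have "\<dots> = (LINT t:B|lborel. f t)"
    using B nn by (subst integral_density) (auto simp: set_lebesgue_integral_def mult.commute)
  finally show "measure M {\<omega> \<in> space M. X \<omega> \<in> B} = (LINT t:B|lborel. f t)" .
qed

text \<open>The hypothesis is tested on the set where \<open>h\<close> is negative: the integral
  there is both nonnegative and minus the integral of the negative part of \<open>h\<close>, so the
  negative part vanishes almost everywhere.\<close>

lemma AE_nonneg_if_set_integrals_nonneg:
  fixes h :: "'a \<Rightarrow> real"
  assumes h: "integrable M h"
    and nn: "\<And>B. B \<in> sets M \<Longrightarrow> 0 \<le> (LINT t:B|M. h t)"
  shows "AE t in M. 0 \<le> h t"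
proof -
  have [measurable]: "h \<in> borel_measurable M"
    using h by simp
  define B where "B = {t \<in> space M. h t < 0}"
  have B: "B \<in> sets M"
    unfolding B_def by measurable
  have "(LINT t|M. max 0 (- h t)) = - (LINT t:B|M. h t)"
    unfolding set_lebesgue_integral_def integral_minus[symmetric]
    by (rule Bochner_Integration.integral_cong) (auto simp: B_def indicator_def)
  with nn[OF B] have "(LINT t|M. max 0 (- h t)) \<le> 0"
    by simp
  then have "(LINT t|M. max 0 (- h t)) = 0"
    by (intro antisym) (auto intro!: integral_nonneg)
  moreover have "integrable M (\<lambda>t. max 0 (- h t))"
    using h by simp
  ultimately have "AE t in M. max 0 (- h t) = 0"
    by (subst (asm) integral_nonneg_eq_0_iff_AE) auto
  then show ?thesis
    by eventually_elim linarith
qed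

text \<open>Countable additivity over the fibres of \<open>X\<close> above the points of
  \<open>C\<close> gives total mass 1 on \<open>C\<close>, and points outside \<open>C\<close> have
  mass 0.\<close>

lemma has_sum_has_pmf:
  assumes "prob_space M" and "has_pmf M X f"
  shows "(f has_sum 1) UNIV"
proof -
  interpret prob_space M by fact
  have [measurable]: "X \<in> borel_measurable M"
    and f: "\<And>t. f t = prob {\<omega> \<in> space M. X \<omega> = t}"
    using assms(2) by (auto simp: has_pmf_def)
  obtain C where C: "countable C" "AE \<omega> in M. X \<omega> \<in> C"
    using assms(2) by (auto simp: has_pmf_def)
  have meas: "{\<omega> \<in> space M. X \<omega> = t} \<in> events" for t
    by measurable
  have "(\<integral>\<^sup>+t. ennreal (f t) \<partial>count_space C)
      = emeasure M (\<Union>t\<in>C. {\<omega> \<in> space M. X \<omega> = t})"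
    using C(1) meas
    by (subst emeasure_UN_countable) (auto simp: f emeasure_eq_measure disjoint_family_on_def)
  also have "\<dots> = emeasure M {\<omega> \<in> space M. X \<omega> \<in> C}"
    by (rule arg_cong[where f = "emeasure M"]) auto
  also have "\<dots> = 1"
  proof (rule emeasure_eq_1_AE)
    have [measurable]: "C \<in> sets borel"
      using C(1) by (rule sets.countable[rotated]) simp
    show "{\<omega> \<in> space M. X \<omega> \<in> C} \<in> events"
      by measurable
    show "AE \<omega> in M. \<omega> \<in> {\<omega> \<in> space M. X \<omega> \<in> C}"
      using C(2) by simp
  qed
  finally have nn: "(\<integral>\<^sup>+t. ennreal (f t) \<partial>count_space C) = 1" .
  have f0: "0 \<le> f t" for t
    by (simp add: f)
  have "integrable (count_space C) f"
    by (rule integrableI_nonneg) (auto simp: nn f0)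
  \<comment> \<open>Integrability for counting measure on \<open>C\<close> is absolute summability,
    which turns the integral into an unordered sum.\<close>
  then have summable: "Infinite_Set_Sum.abs_summable_on f C"
    by (simp add: Infinite_Set_Sum.abs_summable_on_def)
  have "infsetsum f C = 1"
    using integral_eq_nn_integral[of f "count_space C"] nn f0 by (simp add: infsetsum_def)
  with summable have "(f has_sum 1) C"
    using has_sum_infsum[OF abs_summable_summable] infsetsum_infsum[of f C]
    by (metis abs_summable_equivalent)
  moreover have "f t = 0" if "t \<notin> C" for t
  proof -
    have "AE \<omega> in M. \<not> X \<omega> = t"
      using C(2) that by (auto elim!: eventually_mono)
    then show ?thesis
      using meas[of t] by (simp add: f prob_eq_0)
  qed
  ultimately show ?thesis
    by (subst has_sum_cong_neutral[of C UNIV f f]) auto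
qed

theorem theorem8:
  fixes I :: "nat set"
    and A :: "nat \<Rightarrow> real"
    and M :: "nat \<Rightarrow> 'a measure"
    and X :: "nat \<Rightarrow> 'a \<Rightarrow> real"
    and N :: "'b measure"
    and Z :: "'b \<Rightarrow> real"
    and fX :: "nat \<Rightarrow> real \<Rightarrow> real"
    and fZ :: "real \<Rightarrow> real"
    and S :: "real set"
    and g :: "real \<Rightarrow> real"
    and fgX :: "nat \<Rightarrow> real \<Rightarrow> real"
  assumes "finite I"
    and "(\<Sum>i\<in>I. A i) = 1"
    and "\<And>i. i \<in> I \<Longrightarrow> prob_space (M i)"
    and "prob_space N"
    and "\<And>t. fZ t = (\<Sum>i\<in>I. A i * fX i t)"
    and "S \<in> sets borel"
    and "g \<in> borel_measurable (restrict_space borel S)"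
    and "inj_on g S"
    and "\<And>i \<omega>. i \<in> I \<Longrightarrow> \<omega> \<in> space (M i) \<Longrightarrow> X i \<omega> \<in> S"
    and "\<And>\<omega>. \<omega> \<in> space N \<Longrightarrow> Z \<omega> \<in> S"
  shows "((\<forall>i\<in>I. has_pdf (M i) (X i) (fX i)) \<and> has_pdf N Z fZ \<and>
          (\<forall>i\<in>I. has_pdf (M i) (\<lambda>\<omega>. g (X i \<omega>)) (fgX i))
            \<longrightarrow> valid_pdf (\<lambda>y. \<Sum>i\<in>I. A i * fgX i y)) \<and>
         ((\<forall>i\<in>I. has_pmf (M i) (X i) (fX i)) \<and> has_pmf N Z fZ \<and>
          (\<forall>i\<in>I. has_pmf (M i) (\<lambda>\<omega>. g (X i \<omega>)) (fgX i))
            \<longrightarrow> valid_pmf (\<lambda>y. \<Sum>i\<in>I. A i * fgX i y))"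
proof (intro conjI impI; elim conjE)
  assume X: "\<forall>i\<in>I. has_pdf (M i) (X i) (fX i)" and Z: "has_pdf N Z fZ"
    and gX: "\<forall>i\<in>I. has_pdf (M i) (\<lambda>\<omega>. g (X i \<omega>)) (fgX i)"
  let ?h = "\<lambda>y. \<Sum>i\<in>I. A i * fgX i y"
  have intX: "integrable lborel (fX i)" and intgX: "integrable lborel (fgX i)" if "i \<in> I" for i
    using that X gX assms(3) by (auto intro: integrable_has_pdf)
  then have inth: "integrable lborel ?h"
    by (intro Bochner_Integration.integrable_sum integrable_mult_right) auto
  \<comment> \<open>This is used twice: for the \<open>fgX i\<close> on \<open>B\<close> and for the
    \<open>fX i\<close> on the preimage of \<open>B\<close>.\<close>
  have set_int_comb: "(LINT t:B|lborel. \<Sum>i\<in>I. A i * f i t)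
      = (\<Sum>i\<in>I. A i * (LINT t:B|lborel. f i t))"
    if "B \<in> sets borel" "\<And>i. i \<in> I \<Longrightarrow> integrable lborel (f i)"
    for B and f :: "nat \<Rightarrow> real \<Rightarrow> real"
  proof -
    have "integrable lborel (\<lambda>t. indicat_real B t * f i t)" if "i \<in> I" for i
      using integrable_mult_indicator[of B lborel "f i"] that \<open>B \<in> sets borel\<close>
        \<open>\<And>i. i \<in> I \<Longrightarrow> integrable lborel (f i)\<close> by simp
    then show ?thesis
      by (simp add: set_lebesgue_integral_def sum_distrib_left mult.left_commute)
  qed
  have mass: "(LINT y:B|lborel. ?h y) = measure N {\<omega> \<in> space N. Z \<omega> \<in> g -` B \<inter> S}"
    if B: "B \<in> sets borel" for B
  proof -
    \<comment> \<open>\<open>g\<close> is measurable only on \<open>S\<close>; as \<open>S\<close>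
      is Borel, a measurable subset of the restricted space is Borel in the whole line.\<close>
    have T: "g -` B \<inter> S \<in> sets borel"
      using measurable_sets[OF assms(7) B] assms(6)
      by (simp add: space_restrict_space sets_restrict_space_iff)
    have "(LINT y:B|lborel. fgX i y) = (LINT t:g -` B \<inter> S|lborel. fX i t)" if i: "i \<in> I" for i
    proof -
      have "{\<omega> \<in> space (M i). g (X i \<omega>) \<in> B} = {\<omega> \<in> space (M i). X i \<omega> \<in> g -` B \<inter> S}"
        using assms(9) i by auto
      then show ?thesis
        using integrable_has_pdf(2)[OF assms(3) bspec[OF gX] B, OF i i]
          integrable_has_pdf(2)[OF assms(3) bspec[OF X] T, OF i i] by simp
    qed
    then have "(LINT y:B|lborel. ?h y) = (LINT t:g -` B \<inter> S|lborel. fZ t)"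
      using set_int_comb[OF B intgX] set_int_comb[OF T intX] by (simp add: assms(5))
    then show ?thesis
      using integrable_has_pdf(2)[OF assms(4) Z T] by simp
  qed
  \<comment> \<open>By \<open>mass\<close>, every set integral of \<open>?h\<close> is a
    probability.\<close>
  have "AE y in lborel. 0 \<le> ?h y"
    using inth by (rule AE_nonneg_if_set_integrals_nonneg) (simp add: mass)
  moreover have "integral\<^sup>L lborel ?h = 1"
  proof -
    \<comment> \<open>The total integral is \<open>mass\<close> for the whole line, where the event
      is certain because \<open>Z\<close> takes its values in \<open>S\<close>.\<close>
    have "{\<omega> \<in> space N. Z \<omega> \<in> g -` UNIV \<inter> S} = space N"
      using assms(10) by auto
    then show ?thesis
      using mass[of UNIV] prob_space.prob_space[OF assms(4)]
      by (simp add: set_lebesgue_integral_def)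
  qed
  ultimately show "valid_pdf ?h"
    using inth borel_measurable_integrable[OF inth] by (simp add: valid_pdf_def)
next
  assume X: "\<forall>i\<in>I. has_pmf (M i) (X i) (fX i)" and Z: "has_pmf N Z fZ"
    and gX: "\<forall>i\<in>I. has_pmf (M i) (\<lambda>\<omega>. g (X i \<omega>)) (fgX i)"
  let ?h = "\<lambda>y. \<Sum>i\<in>I. A i * fgX i y"
  have "((\<lambda>y. A i * fgX i y) has_sum A i * 1) UNIV" if "i \<in> I" for i
    using that assms(3) gX by (intro has_sum_cmult_right has_sum_has_pmf) auto
  with assms(1) have "(?h has_sum (\<Sum>i\<in>I. A i * 1)) UNIV"
    by (induction I) (auto intro: has_sum_add)
  moreover have "0 \<le> ?h y" for y
  \<comment> \<open>A point \<open>y\<close> of the image has exactly one preimage \<open>x\<close>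
    in \<open>S\<close>, so its combined mass is \<open>fZ x\<close>, a probability. Off the image
    no \<open>g (X i)\<close> takes the value \<open>y\<close>, and all masses are 0.\<close>
  proof (cases "y \<in> g ` S")
    case True
    then obtain x where x: "x \<in> S" "y = g x"
      by auto
    have "fgX i y = fX i x" if i: "i \<in> I" for i
    proof -
      have "{\<omega> \<in> space (M i). g (X i \<omega>) = y} = {\<omega> \<in> space (M i). X i \<omega> = x}"
        using assms(9) i x inj_onD[OF assms(8)] by blast
      then show ?thesis
        using X gX i by (simp add: has_pmf_def)
    qed
    then have "?h y = fZ x"
      by (simp add: assms(5))
    then show ?thesis
      using Z by (simp add: has_pmf_def)
  next
    case False
    have "fgX i y = 0" if i: "i \<in> I" for i
    proof -
      have "fgX i y = measure (M i) {\<omega> \<in> space (M i). g (X i \<omega>) = y}"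
        using gX i by (simp add: has_pmf_def)
      also have "{\<omega> \<in> space (M i). g (X i \<omega>) = y} = {}"
        using assms(9) i False by auto
      finally show ?thesis
        by simp
    qed
    then show ?thesis
      by simp
  qed
  ultimately show "valid_pmf ?h"
    using assms(2) by (simp add: valid_pmf_def)
qed

end
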